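(* Let $L$ be a frame, $X_L$ its Esakia space, and $N(X_L)$ the lattice of nuclear subsets of $X_L$ ordered by inclusion. The join-prime elements of $N(X_L)$ are precisely the singletons $\{y\}$ with $y\in Y_L$.
   Context: A frame is a complete lattice satisfying $a\wedge\bigvee S=\bigvee\{a\wedge s\mid s\in S\}$. The Esakia space $X_L$ of a frame $L$ is the set of prime (proper) filters of $L$, ordered by inclusion, with the topology $\pi$ whose basis is $\{\varphi(a)\setminus\varphi(b)\mid a,b\in L\}$, where $\varphi(a)=\{x\in X_L\mid a\in x\}$. For $S\subseteq X_L$, ${\downarrow}S=\{x\in X_L\mid x\le s\text{ for some }s\in S\}$. A closed subset $F$ of $X_L$ is nuclear if for each clopen $U\subseteq X_L$ the set ${\downarrow}(U\cap F)$ is clopen. $N(X_L)$ is the set of all nuclear subsets of $X_L$, ordered by inclusion; it is a coframe (a complete lattice satisfying $a\vee\bigwedge S=\bigwedge\{a\vee s\mid s\in S\}$) with bottom $\varnothing$ in which binary join is union. $Y_L=\{y\in X_L\mid\{y\}\in N(X_L)\}$ is the set of nuclear points. An element $p$ of a lattice with bottom $0$ is join-prime if $p\ne 0$ and $p\le a\vee b$ implies $p\le a$ or $p\le b$. *)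

theory Defs
  imports "HOL-Algebra.Complete_Lattice" "HOL-Analysis.Abstract_Topology"
begin

locale frame = complete_lattice +
  assumes meet_Sup_distrib:
    "\<lbrakk>a \<in> carrier L; S \<subseteq> carrier L\<rbrakk> \<Longrightarrow> a \<sqinter> (\<Squnion>S) = \<Squnion>{a \<sqinter> s | s. s \<in> S}"

definition prime_filters :: "('a, 'b) gorder_scheme \<Rightarrow> 'a set set"
  where "prime_filters L = {x. x \<subseteq> carrier L \<and> x \<noteq> {} \<and> x \<noteq> carrier L
    \<and> (\<forall>a\<in>x. \<forall>b\<in>carrier L. a \<sqsubseteq>\<^bsub>L\<^esub> b \<longrightarrow> b \<in> x)
    \<and> (\<forall>a\<in>x. \<forall>b\<in>x. a \<sqinter>\<^bsub>L\<^esub> b \<in> x)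
    \<and> (\<forall>a\<in>carrier L. \<forall>b\<in>carrier L. a \<squnion>\<^bsub>L\<^esub> b \<in> x \<longrightarrow> a \<in> x \<or> b \<in> x)}"

definition esakia_phi :: "('a, 'b) gorder_scheme \<Rightarrow> 'a \<Rightarrow> 'a set set"
  where "esakia_phi L a = {x \<in> prime_filters L. a \<in> x}"

(* The sets below are closed under finite intersection, so their unions do form a
   topology when L is a frame: see istopology_esakia. *)
definition esakia_space :: "('a, 'b) gorder_scheme \<Rightarrow> 'a set topology"
  where "esakia_space L = topology (arbitrary union_of
    (\<lambda>U. \<exists>a\<in>carrier L. \<exists>b\<in>carrier L. U = esakia_phi L a - esakia_phi L b))"

definition esakia_down :: "('a, 'b) gorder_scheme \<Rightarrow> 'a set set \<Rightarrow> 'a set set"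
  where "esakia_down L S = {x \<in> prime_filters L. \<exists>s\<in>S. x \<subseteq> s}"

definition clopenin :: "'a topology \<Rightarrow> 'a set \<Rightarrow> bool"
  where "clopenin T U \<longleftrightarrow> openin T U \<and> closedin T U"

definition nuclear_sets :: "('a, 'b) gorder_scheme \<Rightarrow> 'a set set set"
  where "nuclear_sets L = {F. closedin (esakia_space L) F
    \<and> (\<forall>U. clopenin (esakia_space L) U \<longrightarrow> clopenin (esakia_space L) (esakia_down L (U \<inter> F)))}"

(* Bottom and joins are those of the inclusion order, not built in; they are identified
   with {} and union in bottom_nuclear_lattice and join_nuclear_lattice. *)
definition nuclear_lattice :: "('a, 'b) gorder_scheme \<Rightarrow> 'a set set gorder"
  where "nuclear_lattice L = \<lparr>carrier = nuclear_sets L, eq = (=), le = (\<subseteq>)\<rparr>"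

definition nuclear_points :: "('a, 'b) gorder_scheme \<Rightarrow> 'a set set"
  where "nuclear_points L = {y \<in> prime_filters L. {y} \<in> nuclear_sets L}"

definition join_prime :: "('a, 'b) gorder_scheme \<Rightarrow> 'a \<Rightarrow> bool"
  where "join_prime P p \<longleftrightarrow> p \<in> carrier P \<and> p \<noteq> \<bottom>\<^bsub>P\<^esub>
    \<and> (\<forall>a\<in>carrier P. \<forall>b\<in>carrier P. p \<sqsubseteq>\<^bsub>P\<^esub> a \<squnion>\<^bsub>P\<^esub> b \<longrightarrow> p \<sqsubseteq>\<^bsub>P\<^esub> a \<or> p \<sqsubseteq>\<^bsub>P\<^esub> b)"


context frame
begin

lemma esakia_phi_meet:
  assumes a: "a \<in> carrier L" and b: "b \<in> carrier L"
  shows "esakia_phi L (a \<sqinter> b) = esakia_phi L a \<inter> esakia_phi L b"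
proof -
  have "a \<sqinter> b \<in> x \<longleftrightarrow> a \<in> x \<and> b \<in> x" if x: "x \<in> prime_filters L" for x
    using x a b meet_left[OF a b] meet_right[OF a b] unfolding prime_filters_def by blast
  then show ?thesis
    unfolding esakia_phi_def by blast
qed

lemma esakia_phi_join:
  assumes a: "a \<in> carrier L" and b: "b \<in> carrier L"
  shows "esakia_phi L (a \<squnion> b) = esakia_phi L a \<union> esakia_phi L b"
proof -
  have "a \<squnion> b \<in> x \<longleftrightarrow> a \<in> x \<or> b \<in> x" if x: "x \<in> prime_filters L" for x
    using x a b join_left[OF a b] join_right[OF a b] join_closed[OF a b]
    unfolding prime_filters_def by blast
  then show ?thesis
    unfolding esakia_phi_def by blast
qed

lemma esakia_phi_top: "esakia_phi L \<top> = prime_filters L"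
proof -
  have "\<top> \<in> x" if x: "x \<in> prime_filters L" for x
  proof -
    obtain a where "a \<in> x" "a \<in> carrier L"
      using x unfolding prime_filters_def by blast
    then show ?thesis
      using x top_closed top_higher[of a] unfolding prime_filters_def by blast
  qed
  then show ?thesis
    unfolding esakia_phi_def by blast
qed

lemma esakia_phi_bottom: "esakia_phi L \<bottom> = {}"
proof -
  have "\<bottom> \<notin> x" if x: "x \<in> prime_filters L" for x
  proof
    assume "\<bottom> \<in> x"
    moreover obtain b where b: "b \<in> carrier L" "b \<notin> x"
      using x unfolding prime_filters_def by blast
    ultimately show False
      using x bottom_lower[OF b(1)] unfolding prime_filters_def by blast
  qed
  then show ?thesis
    unfolding esakia_phi_def by blast
qed

lemma istopology_esakia:
  "istopology (arbitrary union_of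
    (\<lambda>U. \<exists>a\<in>carrier L. \<exists>b\<in>carrier L. U = esakia_phi L a - esakia_phi L b))"
proof (rule istopology_base)
  fix S T
  assume "\<exists>a\<in>carrier L. \<exists>b\<in>carrier L. S = esakia_phi L a - esakia_phi L b"
    and "\<exists>a\<in>carrier L. \<exists>b\<in>carrier L. T = esakia_phi L a - esakia_phi L b"
  then obtain a b c d where *: "a \<in> carrier L" "b \<in> carrier L" "c \<in> carrier L" "d \<in> carrier L"
    "S = esakia_phi L a - esakia_phi L b" "T = esakia_phi L c - esakia_phi L d"
    by blast
  then have "S \<inter> T = esakia_phi L (a \<sqinter> c) - esakia_phi L (b \<squnion> d)"
    by (simp add: esakia_phi_meet esakia_phi_join) blast
  then show "\<exists>a\<in>carrier L. \<exists>b\<in>carrier L. S \<inter> T = esakia_phi L a - esakia_phi L b"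
    using meet_closed[OF *(1,3)] join_closed[OF *(2,4)] by blast
qed

lemma openin_esakia_space:
  "openin (esakia_space L) = arbitrary union_of
    (\<lambda>U. \<exists>a\<in>carrier L. \<exists>b\<in>carrier L. U = esakia_phi L a - esakia_phi L b)"
  unfolding esakia_space_def by (rule topology_inverse'[OF istopology_esakia])

lemma topspace_esakia_space: "topspace (esakia_space L) = prime_filters L"
proof
  show "topspace (esakia_space L) \<subseteq> prime_filters L"
    unfolding topspace_def openin_esakia_space union_of_def esakia_phi_def by blast
  have "openin (esakia_space L) (prime_filters L)"
    unfolding openin_esakia_space
  proof (rule union_of_inc)
    have "prime_filters L = esakia_phi L \<top> - esakia_phi L \<bottom>"
      by (simp add: esakia_phi_top esakia_phi_bottom)
    then show "\<exists>a\<in>carrier L. \<exists>b\<in>carrier L. prime_filters L = esakia_phi L a - esakia_phi L b"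
      using top_closed bottom_closed by blast
  qed (simp add: arbitrary_def)
  then show "prime_filters L \<subseteq> topspace (esakia_space L)"
    by (rule openin_subset)
qed

end

lemma nuclear_sets_empty: "{} \<in> nuclear_sets L"
  by (simp add: nuclear_sets_def esakia_down_def clopenin_def)

lemma nuclear_sets_Un:
  assumes "F \<in> nuclear_sets L" "G \<in> nuclear_sets L"
  shows "F \<union> G \<in> nuclear_sets L"
proof -
  have "esakia_down L (U \<inter> (F \<union> G)) = esakia_down L (U \<inter> F) \<union> esakia_down L (U \<inter> G)" for U
    by (auto simp: esakia_down_def)
  then show ?thesis
    using assms by (auto simp: nuclear_sets_def clopenin_def)
qed

lemma bottom_nuclear_lattice: "\<bottom>\<^bsub>nuclear_lattice L\<^esub> = {}"
  unfolding bottom_def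
  using nuclear_sets_empty[of L]
  by (intro some_equality) (auto simp: least_def Lower_def nuclear_lattice_def)

lemma join_nuclear_lattice:
  assumes "F \<in> nuclear_sets L" "G \<in> nuclear_sets L"
  shows "F \<squnion>\<^bsub>nuclear_lattice L\<^esub> G = F \<union> G"
proof -
  have "least (nuclear_lattice L) (F \<union> G) (Upper (nuclear_lattice L) {F, G})"
    using assms nuclear_sets_Un[OF assms]
    by (auto simp: least_def Upper_def nuclear_lattice_def)
  moreover have "x = F \<union> G"
    if "least (nuclear_lattice L) x (Upper (nuclear_lattice L) {F, G})" for x
    using that calculation by (auto simp: least_def nuclear_lattice_def)
  ultimately show ?thesis
    unfolding join_def sup_def by (rule some_equality)
qed

end

theory Submission
  imports Defs
begin

text \<open>Splitting a nuclear set along a clopen set gives two nuclear sets. Since the sets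
  \<open>\<phi>(a)\<close> are clopen and separate prime filters, a nuclear set with two distinct points is a
  union of two proper nuclear subsets and hence not join-prime.\<close>

lemma nuclear_sets_Int_clopenin:
  assumes "F \<in> nuclear_sets L" "clopenin (esakia_space L) V"
  shows "V \<inter> F \<in> nuclear_sets L"
proof -
  have "clopenin (esakia_space L) (esakia_down L (U \<inter> (V \<inter> F)))"
    if "clopenin (esakia_space L) U" for U
  proof -
    \<comment> \<open>Testing \<open>V \<inter> F\<close> against \<open>U\<close> is the same as
      testing \<open>F\<close> against \<open>U \<inter> V\<close>, which is again clopen.\<close>
    have "clopenin (esakia_space L) (U \<inter> V)"
      using that assms(2) by (auto simp: clopenin_def)
    then show ?thesis
      using assms(1) by (auto simp: nuclear_sets_def Int_assoc)
  qed
  then show ?thesis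
    using assms by (auto simp: nuclear_sets_def clopenin_def)
qed

lemma clopenin_topspace_Diff:
  "clopenin T U \<Longrightarrow> clopenin T (topspace T - U)"
  by (auto simp: clopenin_def)

context frame
begin

lemma nuclear_sets_subset_prime_filters:
  "F \<in> nuclear_sets L \<Longrightarrow> F \<subseteq> prime_filters L"
  using closedin_subset[of "esakia_space L" F]
  by (simp add: nuclear_sets_def topspace_esakia_space)

lemma openin_esakia_phi_Diff:
  assumes "a \<in> carrier L" "b \<in> carrier L"
  shows "openin (esakia_space L) (esakia_phi L a - esakia_phi L b)"
  unfolding openin_esakia_space
  by (rule union_of_inc) (use assms in \<open>auto simp: arbitrary_def\<close>)

text \<open>Both the set and its complement are basic open: subtract
  \<open>esakia_phi L \<bottom>\<close>, which is empty, or subtract from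
  \<open>esakia_phi L \<top>\<close>, which is the whole space.\<close>

lemma clopenin_esakia_phi:
  assumes "a \<in> carrier L"
  shows "clopenin (esakia_space L) (esakia_phi L a)"
  using openin_esakia_phi_Diff[OF assms bottom_closed] openin_esakia_phi_Diff[OF top_closed assms]
  unfolding clopenin_def closedin_def topspace_esakia_space esakia_phi_top esakia_phi_bottom
  by (simp add: esakia_phi_def subset_eq)

text \<open>An element \<open>a\<close> lying in exactly one of the two filters yields the clopen
  set \<open>esakia_phi L a\<close>, or its complement if \<open>a\<close> belongs to
  \<open>y\<close>.\<close>

lemma prime_filters_separated:
  assumes "x \<in> prime_filters L" "y \<in> prime_filters L" "x \<noteq> y"
  obtains U where "clopenin (esakia_space L) U" "x \<in> U" "y \<notin> U"
proof -
  have *: "\<exists>U. clopenin (esakia_space L) U \<and> u \<in> U \<and> v \<notin> U"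
    if uv: "u \<in> prime_filters L" "v \<in> prime_filters L" "\<not> u \<subseteq> v" for u v
  proof -
    obtain a where "a \<in> u" "a \<notin> v" "a \<in> carrier L"
      using uv unfolding prime_filters_def by blast
    with uv have "u \<in> esakia_phi L a" "v \<notin> esakia_phi L a"
      by (simp_all add: esakia_phi_def)
    then show ?thesis
      using clopenin_esakia_phi[OF \<open>a \<in> carrier L\<close>] by blast
  qed
  show thesis
  proof (cases "x \<subseteq> y")
    case False
    then show thesis
      using *[of x y] assms that by blast
  next
    case True
    then obtain U where "clopenin (esakia_space L) U" "y \<in> U" "x \<notin> U"
      using *[of y x] assms by blast
    \<comment> \<open>Here \<open>U\<close> separates the points the wrong way round, so its
      complement is taken.\<close>
    then show thesis
      using that[OF clopenin_topspace_Diff] assms(1) by (simp add: topspace_esakia_space)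
  qed
qed

text \<open>Turns the order-theoretic notion into plain set theory. The equation for joins requires
  nuclear arguments, which the bounded quantifiers in \<open>join_prime\<close> supply.\<close>

lemma join_prime_nuclear_lattice_iff:
  "join_prime (nuclear_lattice L) F \<longleftrightarrow> F \<in> nuclear_sets L \<and> F \<noteq> {} \<and>
    (\<forall>G\<in>nuclear_sets L. \<forall>H\<in>nuclear_sets L. F \<subseteq> G \<union> H \<longrightarrow> F \<subseteq> G \<or> F \<subseteq> H)"
proof -
  have [simp]: "carrier (nuclear_lattice L) = nuclear_sets L" "le (nuclear_lattice L) = (\<subseteq>)"
    by (simp_all add: nuclear_lattice_def)
  show ?thesis
    by (simp add: join_prime_def bottom_nuclear_lattice join_nuclear_lattice)
qed

lemma join_prime_nuclear_subsingleton:
  assumes "join_prime (nuclear_lattice L) F" "x \<in> F" "y \<in> F"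
  shows "x = y"
proof (rule ccontr)
  assume "x \<noteq> y"
  have F: "F \<in> nuclear_sets L"
    using assms(1) by (simp add: join_prime_nuclear_lattice_iff)
  \<comment> \<open>Used twice: separation applies to points of the space, and \<open>U\<close>
    together with its complement in the space covers \<open>F\<close>.\<close>
  have sub: "F \<subseteq> prime_filters L"
    by (rule nuclear_sets_subset_prime_filters[OF F])
  with \<open>x \<noteq> y\<close> assms obtain U
    where U: "clopenin (esakia_space L) U" "x \<in> U" "y \<notin> U"
    by (meson prime_filters_separated subsetD)
  let ?V = "topspace (esakia_space L) - U"
  have "U \<inter> F \<in> nuclear_sets L" "?V \<inter> F \<in> nuclear_sets L"
    using U F by (simp_all add: nuclear_sets_Int_clopenin clopenin_topspace_Diff)
  moreover have "F \<subseteq> (U \<inter> F) \<union> (?V \<inter> F)"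
    using sub by (auto simp: topspace_esakia_space)
  ultimately have "F \<subseteq> U \<inter> F \<or> F \<subseteq> ?V \<inter> F"
    using assms(1) unfolding join_prime_nuclear_lattice_iff by blast
  \<comment> \<open>Neither half contains \<open>F\<close>: the first misses \<open>y\<close>, the
    second misses \<open>x\<close>.\<close>
  then show False
    using U assms by blast
qed

end

theorem lemma5p7:
  fixes L :: "('a, 'b) gorder_scheme"
  assumes "frame L"
  shows "{p. join_prime (nuclear_lattice L) p} = {{y} | y. y \<in> nuclear_points L}"
proof -
  interpret frame L by fact
  have "\<exists>y\<in>nuclear_points L. F = {y}" if F: "join_prime (nuclear_lattice L) F" for F
  proof -
    have nuc: "F \<in> nuclear_sets L" and "F \<noteq> {}"
      using F by (simp_all add: join_prime_nuclear_lattice_iff)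
    then obtain y where "F = {y}"
      using join_prime_nuclear_subsingleton[OF F] by blast
    then show ?thesis
      using nuc nuclear_sets_subset_prime_filters[OF nuc] by (simp add: nuclear_points_def)
  qed
  \<comment> \<open>A one-point set contained in a union of two sets is contained in one of
    them.\<close>
  moreover have "join_prime (nuclear_lattice L) {y}" if "y \<in> nuclear_points L" for y
    using that by (simp add: join_prime_nuclear_lattice_iff nuclear_points_def)
  ultimately show ?thesis
    by blast
qed

end
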